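(* Let $p_r, p_l, p_d > 0$ with $p_r + p_l + p_d = 1$, and suppose that $p_l + p_d \geq p_r$. Consider the random walk and the resulting random Morse function (with one local minimum) described in the context. Then: (1) The probability that the random walk starting at $(1,0)$ arrives at a point of the form $(0,z)$ is equal to $1$. (2) Let $n \geq 0$ be an even integer. The probability that from a walk a random Morse function is created with $n+2$ critical points on a closed surface is equal to $$\frac{1}{n+1}\binom{n+1}{(n+2)/2}\, p_r^{n/2}(p_l+p_d)^{(n+2)/2}.$$ (3) The expected number of critical points of a random Morse function is $$1+\frac{1}{p_l+p_d-p_r}$$ if $p_l+p_d>p_r$, and $\infty$ if $p_l+p_d=p_r$. (4) Let $y \geq 0$ be an integer and let $n \geq 0$ be an even integer. The probability that during the walk a random Morse function is created with $n+2$ critical points on a closed surface of genus $y$ (that is, the walk starts at $(1,0)$, $S_n=(1,y)$, and the walk finishes at $S_{n+1}=(0,z)$ for some $z$) is equal to $$\frac{1}{n+1}\binom{n+1}{(n+2)/2}\, p_r^{n/2}(p_l+p_d)\binom{n/2}{y}\, p_l^{n/2-y}p_d^{y}.$$ (5) If $p_l+p_d>p_r$, then the expected number of local maxima of a random Morse function with one local minimum is equal to $$\frac{p_d(p_l+p_d-p_r)+p_l/2}{(p_l+p_d)(p_l+p_d-p_r)}.$$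
   Context: Let $\mathcal S=\{(x,y): x,y\in\mathbb Z,\ x\ge 1,\ y\ge 0\}$. A random walk $S_0,S_1,S_2,\dots$ starts at $S_0=(1,0)$ and at each step, independently, moves by $(+1,0)$ (right step) with probability $p_r$, by $(-1,0)$ (left step) with probability $p_l$, and by $(-1,+1)$ (up-and-left, or diagonal, step) with probability $p_d$. The walk stops the first time it leaves $\mathcal S$, which happens by a left or diagonal step from some point $S_n=(1,y)$ to a point $S_{n+1}=(0,z)$; the walk is then said to have length $n$ (the exiting step is not counted in the length). Each walk that leaves $\mathcal S$ builds Morse functions on a connected closed orientable surface as follows. At the start there is one local minimum (a disk with one boundary circle). At a right step within $\mathcal S$ one attaches an upside-down pair of pants to one boundary circle (one index $1$ critical point; the number of boundary circles increases by one). At a left step within $\mathcal S$ one attaches one local maximum (a disk) to one boundary circle. At an up-and-left step within $\mathcal S$ one attaches a pair of pants in the usual position to two boundary circles (one index $1$ critical point; the number of boundary circles decreases by one and the genus increases by one). At the exiting step (left or diagonal) one attaches one final local maximum to the single remaining boundary circle. Thus if the walk has length $n$ and $S_n=(1,y)$, the constructed Morse functions have exactly $n+2$ critical points and exactly one local minimum, and their domain is the closed connected orientable surface of genus $y$; the number of local maxima is one plus the number of left steps among the first $n$ steps. The Morse function is not uniquely determined by the walk, but all these numbers depend only on the walk. Probabilities and expected values for a "random Morse function" are those of the corresponding quantities for the random walk.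
   Formalization: In (5) the printed formula is false (it can be below 1); the numerator is corrected to (p_d + p_l/2)(p_l+p_d-p_r) + p_l/2, with p_d + p_l/2 in place of p_d. *)

theory Defs
  imports "HOL-Probability.Probability"
begin

datatype step = Right_Step | Left_Step | Diag_Step

fun displacement :: "step \<Rightarrow> int \<times> int" where
  "displacement Right_Step = (1, 0)"
| "displacement Left_Step = (-1, 0)"
| "displacement Diag_Step = (-1, 1)"

definition region :: "(int \<times> int) set" where
  "region = {(x, y). x \<ge> 1 \<and> y \<ge> 0}"

(* The stopped walk: once outside the region it stays where it is. *)
primrec position :: "(nat \<Rightarrow> step) \<Rightarrow> nat \<Rightarrow> int \<times> int" where
  "position s 0 = (1, 0)"
| "position s (Suc n) =
     (if position s n \<in> region then position s n + displacement (s n) else position s n)"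

(* The exiting step is not counted in the length. *)
definition has_length :: "(nat \<Rightarrow> step) \<Rightarrow> nat \<Rightarrow> bool" where
  "has_length s n \<longleftrightarrow> position s n \<in> region \<and> position s (Suc n) \<notin> region"

(* The numerical data, determined by the walk, of a Morse function on a connected surface
   with boundary that is built up piece by piece from bottom to top. *)
record morse_data =
  minima :: nat
  saddles :: nat
  maxima :: nat
  circles :: nat  \<comment> \<open>number of boundary circles\<close>
  genus :: nat

definition local_minimum :: morse_data where
  "local_minimum = \<lparr>minima = 1, saddles = 0, maxima = 0, circles = 1, genus = 0\<rparr>"

definition attach_upside_down_pants :: "morse_data \<Rightarrow> morse_data" where
  "attach_upside_down_pants d = d\<lparr>saddles := saddles d + 1, circles := circles d + 1\<rparr>"

definition attach_local_maximum :: "morse_data \<Rightarrow> morse_data" where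
  "attach_local_maximum d = d\<lparr>maxima := maxima d + 1, circles := circles d - 1\<rparr>"

(* Both lower circles of the pair of pants are glued to the same connected surface, hence
   the genus increases. *)
definition attach_pants :: "morse_data \<Rightarrow> morse_data" where
  "attach_pants d =
     d\<lparr>saddles := saddles d + 1, circles := circles d - 1, genus := genus d + 1\<rparr>"

fun attach :: "step \<Rightarrow> morse_data \<Rightarrow> morse_data" where
  "attach Right_Step d = attach_upside_down_pants d"
| "attach Left_Step d = attach_local_maximum d"
| "attach Diag_Step d = attach_pants d"

(* While the walk is in the region, the number of boundary circles is its first coordinate and
   the genus its second one; so the truncated subtractions above never truncate, a pair of
   pants always finds two circles, and the exiting step, whether left or diagonal, caps off
   the only remaining circle. *)
primrec construction :: "(nat \<Rightarrow> step) \<Rightarrow> nat \<Rightarrow> morse_data" where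
  "construction s 0 = local_minimum"
| "construction s (Suc n) =
     (if position s (Suc n) \<in> region then attach (s n) (construction s n)
      else if position s n \<in> region then attach_local_maximum (construction s n)
      else construction s n)"

definition morse_function :: "(nat \<Rightarrow> step) \<Rightarrow> morse_data option" where
  "morse_function s =
     (if \<exists>n. has_length s n then Some (construction s (Suc (THE n. has_length s n))) else None)"

definition closed_surface :: "morse_data \<Rightarrow> bool" where
  "closed_surface d \<longleftrightarrow> circles d = 0"

definition critical_points :: "morse_data \<Rightarrow> nat" where
  "critical_points d = minima d + saddles d + maxima d"

(* The value 0 for walks that never leave the region is a convention; under the hypotheses of
   the main theorem these walks form a null set, so it does not affect expected values. *)
definition num_critical_points :: "(nat \<Rightarrow> step) \<Rightarrow> nat" where
  "num_critical_points s =
     (case morse_function s of None \<Rightarrow> 0 | Some d \<Rightarrow> critical_points d)"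

(* A pitfall: the expected value is p_d / q + p_l / (q - p_r) with q = p_l + p_d > p_r, that is
   ((p_d + p_l / 2) * (q - p_r) + p_l / 2) / (q * (q - p_r)).  The published formula has p_d in
   place of p_d + p_l / 2; it can be smaller than 1 although there is always a local maximum. *)
definition num_local_maxima :: "(nat \<Rightarrow> step) \<Rightarrow> nat" where
  "num_local_maxima s = (case morse_function s of None \<Rightarrow> 0 | Some d \<Rightarrow> maxima d)"

end

theory Submission
  imports Defs "HOL-Analysis.Generalised_Binomial_Theorem"
begin

text \<open>
  Write \<open>q = p_l + p_d\<close>. The first coordinate of the walk does not distinguish left from diagonal
  steps, so it is a walk on the line that starts at 1, goes up with probability \<open>p_r\<close>, down with
  probability \<open>q\<close>, and stops at 0. A walk that stops has even length \<open>2k\<close>, with \<open>k\<close> right steps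
  and \<open>k\<close> other steps before the exiting one; by the reflection principle their
  orders are counted by the Catalan number \<open>C_k\<close>. Independently of the order, each of the \<open>k\<close>
  other steps is diagonal or left, which gives the factor
  \<open>(k choose y) * p_l ^ (k - y) * p_d ^ y\<close> for genus \<open>y\<close>. Since the critical points, the genus and the
  maxima of the constructed function are determined by \<open>k\<close> and \<open>y\<close> (lemma \<open>exits_morse_function\<close>),
  all claims are about these weights.

  The path counts are obtained without bijections. The law of the stopped position at time \<open>n\<close>
  obeys a one-step recursion, because the next step is independent of the past, and the
  reflection formula times the binomial weight satisfies the same recursion (lemma \<open>position_law\<close>).

  What remains are the series of \<open>w_k = C_k * p_r ^ k * q ^ (k + 1)\<close>. Put
  \<open>u_k = (2k choose k) * (p_r * q) ^ k\<close>. The mean number of critical points is governed by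
  \<open>(2k + 2) * w_k = 2 * q * u_k\<close>, and the total mass by \<open>w_k = 2 * q * u_k - u_(k+1) / (2 * p_r)\<close>.
  If \<open>p_r < q\<close>, then the binomial series with exponent \<open>-1/2\<close> gives
  \<open>\<Sum>u_k = 1 / sqrt (1 - 4 * p_r * q) = 1 / (q - p_r)\<close>, which evaluates both series. If \<open>p_r = q = 1/2\<close>,
  then \<open>w_k = u_k - u_(k+1)\<close> telescopes to 1 because \<open>u_k\<close> tends to 0, while \<open>\<Sum>u_k\<close> dominates a multiple of the
  harmonic series and diverges. Finally, a walk of length \<open>2k\<close> has on average
  \<open>1 + k * p_l / q\<close> maxima, so the mean number of maxima is a combination of the same two sums.
\<close>

section \<open>Ballot numbers and central binomial coefficients\<close>

text \<open>
  For \<open>b \<le> a\<close> this is the number of orders of \<open>a\<close> up-steps and \<open>b\<close> down-steps in which no initial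
  segment has more down-steps than up-steps, as given by the reflection principle. Choosing \<open>Suc a\<close>
  rather than the equal \<open>(a + b) choose (b - 1)\<close> avoids a special case at \<open>b = 0\<close>.
\<close>
definition ballot :: "nat \<Rightarrow> nat \<Rightarrow> real" where
  "ballot a b = real ((a + b) choose a) - real ((a + b) choose Suc a)"

lemma ballot_Suc_Suc: "ballot (Suc a) (Suc b) = ballot a (Suc b) + ballot (Suc a) b"
  by (simp add: ballot_def)

lemma ballot_0_right: "ballot a 0 = 1"
  by (simp add: ballot_def)

text \<open>The two binomials are symmetric to each other: a path cannot end just below its barrier.\<close>
lemma ballot_below_diagonal: "ballot a (Suc a) = 0"
proof -
  have "(Suc (2 * a)) choose a = (Suc (2 * a)) choose Suc a"
    by (subst binomial_symmetric) (auto simp: Suc_diff_le)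
  then show ?thesis by (simp add: ballot_def mult_2)
qed

lemma Suc_times_ballot_diagonal: "real (Suc k) * ballot k k = real ((2 * k) choose k)"
proof -
  have "Suc k * ((2 * k) choose Suc k) = k * ((2 * k) choose k)"
    using binomial_absorb_comp[of "2 * k" k] Suc_times_binomial_add[of k "k - 1"]
    by (cases k) (simp_all add: mult_2)
  then have "real (Suc k) * real ((2 * k) choose Suc k) = real k * real ((2 * k) choose k)"
    by (metis of_nat_mult)
  then show ?thesis by (simp add: ballot_def mult_2[symmetric] algebra_simps)
qed

lemma ballot_diagonal_eq:
  "ballot k k = 1 / real (2 * k + 1) * real ((2 * k + 1) choose ((2 * k + 2) div 2))"
proof -
  have "Suc k * (Suc (2 * k) choose Suc k) = Suc (2 * k) * ((2 * k) choose k)"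
    by (rule Suc_times_binomial)
  then have "real (Suc k) * real (Suc (2 * k) choose Suc k) = real (Suc (2 * k)) * (real (Suc k) * ballot k k)"
    by (metis of_nat_mult Suc_times_ballot_diagonal)
  then have "real (Suc (2 * k) choose Suc k) = real (Suc (2 * k)) * ballot k k"
    by (simp only: mult.left_commute[of _ "real (Suc k)"] mult_left_cancel)
  then show ?thesis by simp
qed

lemma central_binomial_Suc:
  "real (Suc k) * real ((2 * Suc k) choose Suc k) = 2 * real (2 * k + 1) * real ((2 * k) choose k)"
proof -
  have "(2 * Suc k) choose Suc k = 2 * (Suc (2 * k) choose Suc k)"
    using binomial_symmetric[of k "Suc (2 * k)"] by (simp add: Suc_diff_le)
  moreover have "Suc k * (Suc (2 * k) choose Suc k) = Suc (2 * k) * ((2 * k) choose k)"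
    by (rule Suc_times_binomial)
  ultimately have "Suc k * ((2 * Suc k) choose Suc k) = 2 * (2 * k + 1) * ((2 * k) choose k)"
    by (metis Suc_eq_plus1 mult.assoc mult.left_commute)
  then show ?thesis by (metis of_nat_mult of_nat_numeral)
qed

text \<open>
  Catalan numbers as differences of central binomial coefficients: this reduces their series to
  the binomial one and makes it telescope in the symmetric case.
\<close>
lemma ballot_diagonal_telescope:
  "ballot k k = 2 * real ((2 * k) choose k) - real ((2 * Suc k) choose Suc k) / 2"
proof -
  have "real (Suc k) * (2 * ballot k k)
      = real (Suc k) * (4 * real ((2 * k) choose k) - real ((2 * Suc k) choose Suc k))"
    unfolding right_diff_distrib central_binomial_Suc mult.left_commute[of "real (Suc k)" 2]
      Suc_times_ballot_diagonal
    by (simp add: algebra_simps)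
  then have "2 * ballot k k = 4 * real ((2 * k) choose k) - real ((2 * Suc k) choose Suc k)"
    by (simp only: mult_left_cancel)
  then show ?thesis by linarith
qed

lemma gbinomial_minus_half: "((- 1 / 2 :: real) gchoose k) * (- 4) ^ k = real ((2 * k) choose k)"
proof (induction k)
  case (Suc k)
  have rec: "real (Suc k) * ((- 1 / 2 :: real) gchoose Suc k) = (- 1 / 2 - real k) * ((- 1 / 2) gchoose k)"
    using gbinomial_mult_1[of "- 1 / 2 :: real" k] by (simp add: algebra_simps)
  have "real (Suc k) * (((- 1 / 2 :: real) gchoose Suc k) * (- 4) ^ Suc k)
      = (real (Suc k) * ((- 1 / 2 :: real) gchoose Suc k)) * ((- 4) * (- 4) ^ k)"
    by (simp only: power_Suc mult.assoc)
  also have "\<dots> = 2 * real (2 * k + 1) * (((- 1 / 2) gchoose k) * (- 4) ^ k)"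
    unfolding rec by (simp add: algebra_simps)
  also have "\<dots> = real (Suc k) * real ((2 * Suc k) choose Suc k)"
    by (simp only: Suc.IH central_binomial_Suc)
  finally show ?case by (simp only: mult_left_cancel)
qed simp

lemma central_binomial_sums:
  fixes z :: real
  assumes "\<bar>4 * z\<bar> < 1"
  shows "(\<lambda>k. real ((2 * k) choose k) * z ^ k) sums (1 / sqrt (1 - 4 * z))"
proof -
  have "(\<lambda>k. ((- 1 / 2) gchoose k) * (- 4 * z) ^ k) sums (1 + - 4 * z) powr (- 1 / 2)"
    using assms by (intro gen_binomial_real) auto
  moreover have "(1 + - 4 * z) powr (- 1 / 2) = 1 / sqrt (1 - 4 * z)"
    using assms by (simp add: powr_minus powr_half_sqrt field_simps)
  moreover have "((- 1 / 2 :: real) gchoose k) * (- 4 * z) ^ k = real ((2 * k) choose k) * z ^ k" for k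
    unfolding power_mult_distrib gbinomial_minus_half[symmetric] by (simp add: mult.assoc)
  ultimately show ?thesis by simp
qed

text \<open>
  The square of the quotient, multiplied by \<open>2 * k + 1\<close>, starts at 1 and decreases in \<open>k\<close>, since its
  consecutive values have ratio \<open>(2 * k + 1) * (2 * k + 3) / (2 * k + 2)\<^sup>2\<close>, which is less than 1; so the quotient is at most
  \<open>1 / sqrt (2 * k + 1)\<close>.
\<close>
lemma central_binomial_tendsto_0: "(\<lambda>k. real ((2 * k) choose k) / 4 ^ k) \<longlonglongrightarrow> 0"
proof (rule tendsto_0_le)
  have le: "(real ((2 * k) choose k) / 4 ^ k)\<^sup>2 * real (2 * k + 1) \<le> 1" for k
  proof (induction k)
    case (Suc k)
    define u v where "u = real ((2 * k) choose k) / 4 ^ k"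
      and "v = real ((2 * Suc k) choose Suc k) / 4 ^ Suc k"
    have "real (2 * k + 2) * v = real (2 * k + 1) * u"
    proof -
      have two: "real (2 * k + 2) = 2 * real (Suc k)"
        by simp
      have "real (2 * k + 2) * v = 2 * (real (Suc k) * real ((2 * Suc k) choose Suc k)) / 4 ^ Suc k"
        unfolding v_def two by (simp only: mult.assoc times_divide_eq_right)
      then show ?thesis
        unfolding central_binomial_Suc u_def by (simp add: field_simps)
    qed
    then have v: "v = real (2 * k + 1) / real (2 * k + 2) * u"
      by (simp add: field_simps)
    have "v\<^sup>2 * real (2 * Suc k + 1)
        = (u\<^sup>2 * real (2 * k + 1)) * (real (2 * k + 1) * real (2 * k + 3) / (real (2 * k + 2))\<^sup>2)"
      unfolding v by (simp add: power_mult_distrib power_divide power2_eq_square)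
    also have "\<dots> \<le> 1 * 1"
    proof (intro mult_mono)
      have "real (2 * k + 1) * real (2 * k + 3) \<le> (real (2 * k + 2))\<^sup>2"
        by (simp add: power2_eq_square algebra_simps)
      then show "real (2 * k + 1) * real (2 * k + 3) / (real (2 * k + 2))\<^sup>2 \<le> 1"
        by (intro divide_le_eq_1[THEN iffD2]) auto
    qed (use Suc.IH in \<open>simp_all add: u_def\<close>)
    finally show ?case by (simp add: v_def)
  qed simp
  show "\<forall>\<^sub>F k in sequentially.
      norm (real ((2 * k) choose k) / 4 ^ k) \<le> norm (1 / sqrt (real (2 * k + 1))) * 1"
  proof (rule always_eventually, rule allI)
    fix k
    have "(real ((2 * k) choose k) / 4 ^ k)\<^sup>2 \<le> 1 / real (2 * k + 1)"
      using le[of k] by (simp add: field_simps)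
    then have "real ((2 * k) choose k) / 4 ^ k \<le> sqrt (1 / real (2 * k + 1))"
      by (rule real_le_rsqrt)
    then show "norm (real ((2 * k) choose k) / 4 ^ k) \<le> norm (1 / sqrt (real (2 * k + 1))) * 1"
      by (simp add: real_sqrt_divide)
  qed
  show "(\<lambda>k. 1 / sqrt (real (2 * k + 1))) \<longlonglongrightarrow> 0"
    by real_asymp
qed

section \<open>The series of exit probabilities\<close>

text \<open>
  Here \<open>r\<close> and \<open>q\<close> are the probabilities of an up-step and of a down-step of the first coordinate, so that
  \<open>ballot k k * r ^ k * q ^ Suc k\<close> is the probability of length \<open>2 * k\<close>. The subtracted term is the next value of
  \<open>real ((2 * k) choose k) * (r * q) ^ k\<close>, divided by \<open>2 * r\<close>; for \<open>r = q = 1 / 2\<close> the right-hand side telescopes.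
\<close>
lemma exit_weight_telescope:
  fixes r q :: real
  assumes "0 < r"
  shows "ballot k k * r ^ k * q ^ Suc k
     = 2 * q * (real ((2 * k) choose k) * (r * q) ^ k)
       - real ((2 * Suc k) choose Suc k) * (r * q) ^ Suc k / (2 * r)"
  unfolding ballot_diagonal_telescope using assms
  by (simp add: power_mult_distrib field_simps del: binomial_Suc_Suc)

lemma mean_weight_eq:
  fixes r q :: real
  shows "real (2 * k + 2) * (ballot k k * r ^ k * q ^ Suc k)
     = 2 * q * (real ((2 * k) choose k) * (r * q) ^ k)"
proof -
  have "real (2 * k + 2) * (ballot k k * r ^ k * q ^ Suc k)
      = 2 * q * ((real (Suc k) * ballot k k) * (r * q) ^ k)"
    by (simp add: power_mult_distrib algebra_simps)
  then show ?thesis by (simp only: Suc_times_ballot_diagonal)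
qed

context
  fixes r q :: real
  assumes r: "0 < r" and rq: "r \<le> q" "r + q = 1"
begin

text \<open>For \<open>r + q = 1\<close> the discriminant \<open>1 - 4 * (r * q)\<close> of the binomial series is \<open>(q - r)\<^sup>2\<close>.\<close>
lemma central_binomial_sums_drift:
  assumes "r < q"
  shows "(\<lambda>k. real ((2 * k) choose k) * (r * q) ^ k) sums (1 / (q - r))"
proof -
  have sq: "1 - 4 * (r * q) = (q - r)\<^sup>2"
  proof -
    have "q = 1 - r" using rq(2) by simp
    then show ?thesis unfolding \<open>q = 1 - r\<close> by (simp add: power2_eq_square algebra_simps)
  qed
  have "0 < (q - r)\<^sup>2" using assms by simp
  then have "\<bar>4 * (r * q)\<bar> < 1" using r rq(1) unfolding sq[symmetric] by simp
  from central_binomial_sums[OF this] show ?thesis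
    using assms by (simp add: sq)
qed

lemma exit_weights_sum_1: "(\<lambda>k. ballot k k * r ^ k * q ^ Suc k) sums 1"
proof (cases "r < q")
  case True
  let ?u = "\<lambda>k. real ((2 * k) choose k) * (r * q) ^ k"
  note u = central_binomial_sums_drift[OF True]
  have "(\<lambda>k. ?u (Suc k)) sums (1 / (q - r) - 1)"
    using u by (subst sums_Suc_iff) simp
  then have "(\<lambda>k. 2 * q * ?u k - ?u (Suc k) / (2 * r)) sums
      (2 * q * (1 / (q - r)) - (1 / (q - r) - 1) / (2 * r))"
    by (intro sums_diff sums_mult sums_divide u)
  moreover have "2 * q * (1 / (q - r)) - (1 / (q - r) - 1) / (2 * r) = 1"
  proof -
    have "1 / (q - r) - 1 = 2 * r / (q - r)"
      using True rq(2) by (simp add: field_simps)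
    then have "2 * q * (1 / (q - r)) - (1 / (q - r) - 1) / (2 * r) = (2 * q - 1) / (q - r)"
      using r by (simp add: diff_divide_distrib)
    moreover have "2 * q - 1 = q - r" using rq(2) by simp
    ultimately show ?thesis using True by simp
  qed
  ultimately show ?thesis unfolding exit_weight_telescope[OF r] by simp
next
  case False
  then have half: "r = 1 / 2" "q = 1 / 2" using rq by auto
  let ?u = "\<lambda>k. real ((2 * k) choose k) / 4 ^ k"
  have "(\<lambda>k. ?u k - ?u (Suc k)) sums (?u 0 - 0)"
    by (rule telescope_sums'[OF central_binomial_tendsto_0])
  moreover have "ballot k k * r ^ k * q ^ Suc k = ?u k - ?u (Suc k)" for k
    unfolding exit_weight_telescope[OF r] by (simp add: half power_divide del: binomial_Suc_Suc)
  ultimately show ?thesis by simp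
qed

lemma mean_weights_sum:
  assumes "r < q"
  shows "(\<lambda>k. real (2 * k + 2) * (ballot k k * r ^ k * q ^ Suc k)) sums (1 + 1 / (q - r))"
proof -
  have "2 * q * (1 / (q - r)) = 1 + 1 / (q - r)"
    using assms rq(2) by (simp add: field_simps)
  then show ?thesis
    unfolding mean_weight_eq by (metis sums_mult central_binomial_sums_drift[OF assms])
qed

lemma mean_weights_diverge:
  assumes "r = q"
  shows "\<not> summable (\<lambda>k. real (2 * k + 2) * (ballot k k * r ^ k * q ^ Suc k))"
proof
  have half: "r = 1 / 2" "q = 1 / 2" using rq(2) assms by auto
  assume "summable (\<lambda>k. real (2 * k + 2) * (ballot k k * r ^ k * q ^ Suc k))"
  then have "summable (\<lambda>k. real ((2 * k) choose k) / 4 ^ k)"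
    unfolding mean_weight_eq by (simp add: half power_divide)
  then have "summable (\<lambda>k. 2 * (real ((2 * k) choose k) / 4 ^ k))"
    by (rule summable_mult)
  then have "summable (\<lambda>k. 1 / real k)"
  proof (rule summable_comparison_test'[where N = 1])
    fix k :: nat assume "1 \<le> k"
    then show "norm (1 / real k) \<le> 2 * (real ((2 * k) choose k) / 4 ^ k)"
      using central_binomial_lower_bound[of k] by (simp add: field_simps)
  qed
  then show False using not_summable_harmonic[where 'a = real] by (simp add: inverse_eq_divide)
qed

end

section \<open>From walks to Morse data\<close>

lemma position_cong:
  assumes "\<And>i. i < n \<Longrightarrow> s i = t i"
  shows "position s n = position t n"
  using assms by (induction n) simp_all

lemma region_iff: "p \<in> region \<longleftrightarrow> 1 \<le> fst p \<and> 0 \<le> snd p"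
  by (cases p) (simp add: region_def)

lemma region_Suc_imp: "position s (Suc n) \<in> region \<Longrightarrow> position s n \<in> region"
  by (auto split: if_splits)

lemma region_antimono: "m \<le> n \<Longrightarrow> position s n \<in> region \<Longrightarrow> position s m \<in> region"
  by (induction rule: inc_induct) (use region_Suc_imp in blast)+

text \<open>
  The last equation is a parity count: a right step adds one circle, a left step trades a circle for
  a maximum, a diagonal step trades a circle for a handle, so each step raises the left-hand side by
  one. It ties the length of a walk to its maxima and its genus.
\<close>
lemma construction_invariant:
  assumes "position s n \<in> region"
  shows "minima (construction s n) = 1"
    and "saddles (construction s n) + maxima (construction s n) = n"
    and "int (circles (construction s n)) = fst (position s n)"
    and "int (genus (construction s n)) = snd (position s n)"
    and "2 * (maxima (construction s n) + genus (construction s n)) + circles (construction s n) = n + 1"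
proof -
  have "minima (construction s n) = 1
    \<and> saddles (construction s n) + maxima (construction s n) = n
    \<and> int (circles (construction s n)) = fst (position s n)
    \<and> int (genus (construction s n)) = snd (position s n)
    \<and> 2 * (maxima (construction s n) + genus (construction s n)) + circles (construction s n) = n + 1"
    using assms
  proof (induction n)
    case 0
    then show ?case by (simp add: local_minimum_def)
  next
    case (Suc n)
    have reg: "position s n \<in> region" by (rule region_Suc_imp[OF Suc.prems])
    note IH = Suc.IH[OF reg]
    have pos: "position s (Suc n) = position s n + displacement (s n)"
      using reg by simp
    have con: "construction s (Suc n) = attach (s n) (construction s n)"
      using Suc.prems by simp
    have "1 \<le> fst (position s (Suc n))"
      using Suc.prems by (simp only: region_iff)
    then show ?case
      using IH unfolding pos con
      by (cases "s n")
         (auto simp: attach_upside_down_pants_def attach_local_maximum_def attach_pants_def)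
  qed
  then show "minima (construction s n) = 1"
    and "saddles (construction s n) + maxima (construction s n) = n"
    and "int (circles (construction s n)) = fst (position s n)"
    and "int (genus (construction s n)) = snd (position s n)"
    and "2 * (maxima (construction s n) + genus (construction s n)) + circles (construction s n) = n + 1"
    by auto
qed

lemma position_bound: "position s n \<in> region \<Longrightarrow> fst (position s n) \<le> int n + 1"
  using construction_invariant(3,5)[of s n] by linarith

text \<open>
  The event by which everything is expressed: the walk has length \<open>2 * k\<close> and produces a surface of
  genus \<open>y\<close>. It depends on the first \<open>2 * k + 1\<close> steps only.
\<close>
definition exits :: "(nat \<Rightarrow> step) \<Rightarrow> nat \<Rightarrow> nat \<Rightarrow> bool" where
  "exits s k y \<longleftrightarrow> position s (2 * k) = (1, int y) \<and> s (2 * k) \<noteq> Right_Step"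

lemma has_length_unique:
  assumes "has_length s m" "has_length s n"
  shows "m = n"
proof -
  have False if "has_length s m" "has_length s n" "m < n" for m n
    using region_antimono[of "Suc m" n s] that unfolding has_length_def by (metis Suc_leI)
  then show ?thesis using assms by (metis nat_neq_iff)
qed

lemma exits_position_Suc: "exits s k y \<Longrightarrow> \<exists>z. position s (Suc (2 * k)) = (0, z)"
  by (cases "s (2 * k)") (simp_all add: exits_def region_def)

lemma exits_imp_has_length: "exits s k y \<Longrightarrow> has_length s (2 * k)"
  using exits_position_Suc[of s k y]
  by (auto simp: has_length_def exits_def region_def simp del: position.simps)

text \<open>Lengths are even because the parity count holds with exactly one boundary circle left.\<close>
lemma has_length_imp_exits:
  assumes "has_length s n"
  obtains k y where "n = 2 * k" "exits s k y"
proof -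
  have reg: "position s n \<in> region" and out: "position s n + displacement (s n) \<notin> region"
    using assms by (auto simp: has_length_def)
  have step: "s n \<noteq> Right_Step" and fst1: "fst (position s n) = 1"
    using reg out by (cases "s n"; auto simp: region_iff)+
  note inv = construction_invariant[OF reg]
  have pos: "position s n = (1, int (genus (construction s n)))"
    using fst1 inv(4) by (simp add: prod_eq_iff)
  have "circles (construction s n) = 1" using inv(3) fst1 by simp
  then have "n = 2 * (maxima (construction s n) + genus (construction s n))"
    using inv(5) by simp
  then show thesis using that step pos unfolding exits_def by metis
qed

lemma exits_unique: "exits s k y \<Longrightarrow> exits s k' y' \<Longrightarrow> k = k' \<and> y = y'"
  using has_length_unique[OF exits_imp_has_length exits_imp_has_length, of s k y k' y']
  unfolding exits_def by force

text \<open>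
  At time \<open>2 * k\<close> the parity count shows that the maxima attached so far and the genus add up to \<open>k\<close>;
  the exiting step adds the one further maximum and closes the last circle.
\<close>
lemma exits_morse_function:
  assumes "exits s k y"
  shows "y \<le> k"
    and "\<exists>d. morse_function s = Some d \<and> closed_surface d \<and> genus d = y
           \<and> critical_points d = 2 * k + 2 \<and> maxima d = 1 + k - y"
proof -
  have len: "has_length s (2 * k)" by (rule exits_imp_has_length[OF assms])
  have reg: "position s (2 * k) \<in> region" and out: "position s (Suc (2 * k)) \<notin> region"
    using len by (auto simp: has_length_def)
  define d where "d = construction s (2 * k)"
  note inv = construction_invariant[OF reg, folded d_def]
  have cir: "circles d = 1" and gen: "genus d = y"
    using assms inv(3,4) by (simp_all add: exits_def)
  have max: "maxima d + y = k" using inv(5) cir gen by simp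
  then show "y \<le> k" by simp
  have "(THE n. has_length s n) = 2 * k"
    using len by (auto intro: has_length_unique)
  then have "morse_function s = Some (attach_local_maximum d)"
    using len reg out by (auto simp: morse_function_def d_def simp del: position.simps)
  then show "\<exists>d. morse_function s = Some d \<and> closed_surface d \<and> genus d = y
           \<and> critical_points d = 2 * k + 2 \<and> maxima d = 1 + k - y"
    using inv(1,2) cir gen max
    by (auto simp: attach_local_maximum_def closed_surface_def critical_points_def)
qed

lemma morse_function_Some_imp_exits:
  assumes "morse_function s = Some d"
  obtains k y where "exits s k y"
  using assms has_length_imp_exits by (metis morse_function_def option.distinct(1))

lemma reaches_axis_iff_exits: "(\<exists>n z. position s n = (0, z)) \<longleftrightarrow> (\<exists>k y. exits s k y)"
proof
  assume "\<exists>n z. position s n = (0, z)"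
  then obtain n z where "position s n = (0, z)" by blast
  then have n: "position s n \<notin> region" by (simp add: region_iff)
  define m where "m = (LEAST n. position s n \<notin> region)"
  have m: "position s m \<notin> region" unfolding m_def using n by (rule LeastI)
  then obtain l where l: "m = Suc l" by (cases m) (auto simp: region_def)
  then have "position s l \<in> region"
    using not_less_Least[of l "\<lambda>n. position s n \<notin> region"] unfolding m_def by auto
  then have "has_length s l" using m l by (simp add: has_length_def)
  then show "\<exists>k y. exits s k y" by (metis has_length_imp_exits)
next
  assume "\<exists>k y. exits s k y"
  then show "\<exists>n z. position s n = (0, z)" using exits_position_Suc by blast
qed

lemma morse_function_genus_iff:
  "(\<exists>d. morse_function s = Some d \<and> closed_surface d \<and> genus d = y \<and> critical_points d = 2 * k + 2)
     \<longleftrightarrow> exits s k y"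
proof
  assume "\<exists>d. morse_function s = Some d \<and> closed_surface d \<and> genus d = y
    \<and> critical_points d = 2 * k + 2"
  then obtain d where d: "morse_function s = Some d" "genus d = y" "critical_points d = 2 * k + 2"
    by blast
  obtain k' y' where ex: "exits s k' y'" by (rule morse_function_Some_imp_exits[OF d(1)])
  then show "exits s k y" using exits_morse_function(2)[OF ex] d by auto
qed (use exits_morse_function(2) in blast)

lemma morse_function_size_iff:
  "(\<exists>d. morse_function s = Some d \<and> closed_surface d \<and> critical_points d = 2 * k + 2)
     \<longleftrightarrow> (\<exists>y\<le>k. exits s k y)"
  using morse_function_genus_iff[of s _ k] exits_morse_function(1)[of s k] by blast

lemma position_exit_iff:
  "position s (2 * k) = (1, int y) \<and> (\<exists>z. position s (2 * k + 1) = (0, z)) \<longleftrightarrow> exits s k y"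
  by (cases "s (2 * k)") (auto simp: exits_def region_def)

lemma num_critical_points_exits: "exits s k y \<Longrightarrow> num_critical_points s = 2 * k + 2"
  using exits_morse_function(2)[of s k y] by (auto simp: num_critical_points_def)

lemma num_local_maxima_exits: "exits s k y \<Longrightarrow> num_local_maxima s = 1 + k - y"
  using exits_morse_function(2)[of s k y] by (auto simp: num_local_maxima_def)

lemma num_no_exit:
  assumes "\<nexists>k y. exits s k y"
  shows "num_critical_points s = 0" "num_local_maxima s = 0"
  using assms morse_function_Some_imp_exits[of s]
  by (auto simp: num_critical_points_def num_local_maxima_def split: option.split)

section \<open>Dividing the downward steps into left and diagonal ones\<close>

text \<open>
  The total weight of the ways to declare \<open>y\<close> of \<open>b\<close> downward steps diagonal and the others left.
\<close>
definition split_weight :: "real \<Rightarrow> real \<Rightarrow> nat \<Rightarrow> nat \<Rightarrow> real" where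
  "split_weight l d b y = real (b choose y) * l ^ (b - y) * d ^ y"

lemma split_weight_Suc:
  "split_weight l d (Suc b) y
     = l * split_weight l d b y + (if y = 0 then 0 else d * split_weight l d b (y - 1))"
proof (cases y)
  case (Suc y')
  consider "y \<le> b" | "y' = b" | "b < y'" using Suc by linarith
  then show ?thesis
  proof cases
    case 1
    then have "b - y' = Suc (b - y)" using Suc by simp
    then show ?thesis using Suc by (simp add: split_weight_def algebra_simps)
  qed (use Suc in \<open>simp_all add: split_weight_def binomial_eq_0\<close>)
qed (simp add: split_weight_def)

lemma split_weight_sum: "(\<Sum>y\<le>b. split_weight l d b y) = (l + d) ^ b"
  by (simp add: split_weight_def binomial_ring[of d l b] add.commute[of l] mult_ac)

text \<open>
  The mean of a binomial distribution, not normalised, in the form in which the maxima need it: one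
  final maximum and one for each left step.
\<close>
lemma split_weight_mean:
  "(\<Sum>y\<le>b. real (1 + b - y) * split_weight l d b y)
     = (l + d) ^ b + real b * l * (l + d) ^ (b - 1)"
proof (cases b)
  case (Suc c)
  have absorb: "real (b - y) * split_weight l d b y = real b * l * split_weight l d c y" if "y \<le> c" for y
  proof -
    have "real (b - y) * real (b choose y) = real b * real (c choose y)"
      using binomial_absorb_comp[of b y] unfolding Suc by (metis of_nat_mult diff_Suc_1)
    moreover have "l ^ (b - y) = l * l ^ (c - y)"
      using that Suc by (simp add: Suc_diff_le)
    ultimately show ?thesis
      unfolding split_weight_def by (simp only: mult.assoc[symmetric]) (simp add: mult_ac)
  qed
  have "(\<Sum>y\<le>b. real (1 + b - y) * split_weight l d b y)
      = (\<Sum>y\<le>b. split_weight l d b y) + (\<Sum>y\<le>b. real (b - y) * split_weight l d b y)"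
    unfolding sum.distrib[symmetric] by (intro sum.cong) (auto simp: Suc_diff_le algebra_simps)
  also have "(\<Sum>y\<le>b. real (b - y) * split_weight l d b y)
      = (\<Sum>y\<le>c. real (b - y) * split_weight l d b y)"
    unfolding Suc by simp
  also have "\<dots> = real b * l * (\<Sum>y\<le>c. split_weight l d c y)"
    unfolding sum_distrib_left by (intro sum.cong) (use absorb in auto)
  finally show ?thesis unfolding split_weight_sum by (simp add: Suc)
qed (simp add: split_weight_def)

section \<open>The law of the stopped walk\<close>

locale random_walk = prob_space M
  for M :: "'a measure" +
  fixes X :: "nat \<Rightarrow> 'a \<Rightarrow> step" and p :: "step \<Rightarrow> real"
  assumes indep: "indep_vars (\<lambda>_. count_space UNIV) X UNIV"
    and step_prob: "prob {\<omega> \<in> space M. X i \<omega> = s} = p s"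
begin

abbreviation path :: "'a \<Rightarrow> nat \<Rightarrow> step" where
  "path \<omega> \<equiv> \<lambda>i. X i \<omega>"

text \<open>
  The steps take finitely many values, so the product space of the first \<open>n\<close> steps is discrete. Hence
  every predicate of them is an event, and independence of the blocks \<open>{..<n}\<close> and
  \<open>{n}\<close> gives the product formula.
\<close>
lemma past_measurable_and_independent:
  assumes "\<And>s t. (\<And>i. i < n \<Longrightarrow> s i = t i) \<Longrightarrow> Q s = Q t"
  shows "{\<omega> \<in> space M. Q (path \<omega>)} \<in> events"
    and "prob {\<omega> \<in> space M. Q (path \<omega>) \<and> X n \<omega> = s}
           = prob {\<omega> \<in> space M. Q (path \<omega>)} * p s"
proof -
  have UNIV_step: "(UNIV :: step set) = {Right_Step, Left_Step, Diag_Step}"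
    using step.exhaust by auto
  then have fin: "countable (UNIV :: step set)" by (metis countable_finite finite.intros)
  define past where "past = (\<lambda>\<omega>. restrict (path \<omega>) {..<n})"
  define now where "now = (\<lambda>\<omega>. restrict (path \<omega>) {n})"
  have ind: "indep_var (PiM {..<n} (\<lambda>_. count_space UNIV)) past (PiM {n} (\<lambda>_. count_space UNIV)) now"
    unfolding past_def now_def by (rule indep_var_restrict[OF indep]) auto
  have PiM_eq: "PiM I (\<lambda>_. count_space (UNIV :: step set)) = count_space (PiE I (\<lambda>_. UNIV))"
    if "finite I" for I :: "nat set"
    using that fin by (rule count_space_PiM_finite)
  let ?A = "{f \<in> PiE {..<n} (\<lambda>_. UNIV). Q f}" and ?B = "{f \<in> PiE {n} (\<lambda>_. UNIV). f n = s}"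
  have Q: "Q (past \<omega>) = Q (path \<omega>)" for \<omega>
    by (rule assms) (simp add: past_def)
  have past: "past -` ?A \<inter> space M = {\<omega> \<in> space M. Q (path \<omega>)}"
    using Q by (auto simp: past_def)
  have now: "now -` ?B \<inter> space M = {\<omega> \<in> space M. X n \<omega> = s}"
    by (auto simp: now_def)
  have both: "(\<lambda>\<omega>. (past \<omega>, now \<omega>)) -` (?A \<times> ?B) \<inter> space M
      = {\<omega> \<in> space M. Q (path \<omega>) \<and> X n \<omega> = s}"
    using past now by blast
  have A: "?A \<in> sets (PiM {..<n} (\<lambda>_. count_space UNIV))"
    and B: "?B \<in> sets (PiM {n} (\<lambda>_. count_space UNIV))"
    by (auto simp: PiM_eq)
  show "{\<omega> \<in> space M. Q (path \<omega>)} \<in> events"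
    using measurable_sets[OF indep_var_rv1[OF ind] A] past by simp
  show "prob {\<omega> \<in> space M. Q (path \<omega>) \<and> X n \<omega> = s}
      = prob {\<omega> \<in> space M. Q (path \<omega>)} * p s"
    using indep_varD[OF ind A B] unfolding both past now step_prob .
qed

lemma exits_events [measurable]: "{\<omega> \<in> space M. exits (path \<omega>) k y} \<in> events"
proof (rule past_measurable_and_independent(1)[of "Suc (2 * k)"])
  fix s t :: "nat \<Rightarrow> step"
  assume eq: "\<And>i. i < Suc (2 * k) \<Longrightarrow> s i = t i"
  then have "position s (2 * k) = position t (2 * k)" by (intro position_cong) simp
  then show "exits s k y = exits t k y" using eq by (simp add: exits_def)
qed

definition position_prob :: "nat \<Rightarrow> int \<Rightarrow> int \<Rightarrow> real" where
  "position_prob n x y = prob {\<omega> \<in> space M. position (path \<omega>) n = (x, y)}"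

lemma position_step_prob:
  "{\<omega> \<in> space M. position (path \<omega>) n = v \<and> X n \<omega> = s} \<in> events"
  "prob {\<omega> \<in> space M. position (path \<omega>) n = v \<and> X n \<omega> = s}
     = position_prob n (fst v) (snd v) * p s"
proof -
  show "{\<omega> \<in> space M. position (path \<omega>) n = v \<and> X n \<omega> = s} \<in> events"
  proof (rule past_measurable_and_independent(1)[of "Suc n"])
    fix s' t :: "nat \<Rightarrow> step"
    assume eq: "\<And>i. i < Suc n \<Longrightarrow> s' i = t i"
    then have "position s' n = position t n" by (intro position_cong) simp
    then show "(position s' n = v \<and> s' n = s) = (position t n = v \<and> t n = s)"
      using eq by simp
  qed
  show "prob {\<omega> \<in> space M. position (path \<omega>) n = v \<and> X n \<omega> = s}
      = position_prob n (fst v) (snd v) * p s"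
    unfolding position_prob_def prod.collapse
    by (rule past_measurable_and_independent(2)) (metis position_cong)
qed

text \<open>
  Each target has one predecessor per kind of step; the guards discard the predecessors outside the
  region, at which the walk has stopped.
\<close>
lemma position_prob_Suc:
  assumes "1 \<le> x" "0 \<le> y"
  shows "position_prob (Suc n) x y
    = (if 2 \<le> x then p Right_Step * position_prob n (x - 1) y else 0)
      + p Left_Step * position_prob n (x + 1) y
      + (if 1 \<le> y then p Diag_Step * position_prob n (x + 1) (y - 1) else 0)"
proof -
  let ?E = "\<lambda>v s. {\<omega> \<in> space M. position (path \<omega>) n = v \<and> X n \<omega> = s}"
  let ?R = "if 2 \<le> x then ?E (x - 1, y) Right_Step else {}"
  let ?L = "?E (x + 1, y) Left_Step"
  let ?D = "if 1 \<le> y then ?E (x + 1, y - 1) Diag_Step else {}"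
  have meas: "?R \<in> events" "?L \<in> events" "?D \<in> events"
    using position_step_prob(1) by auto
  have "position s (Suc n) = (x, y) \<longleftrightarrow>
      (2 \<le> x \<and> position s n = (x - 1, y) \<and> s n = Right_Step)
      \<or> (position s n = (x + 1, y) \<and> s n = Left_Step)
      \<or> (1 \<le> y \<and> position s n = (x + 1, y - 1) \<and> s n = Diag_Step)" for s
    using assms by (cases "s n"; cases "position s n") (auto simp: region_def)
  then have "{\<omega> \<in> space M. position (path \<omega>) (Suc n) = (x, y)} = (?R \<union> ?L) \<union> ?D"
    by (auto simp del: position.simps)
  then have "position_prob (Suc n) x y = prob ((?R \<union> ?L) \<union> ?D)"
    by (simp only: position_prob_def)
  also have "\<dots> = prob (?R \<union> ?L) + prob ?D"
    using meas by (intro finite_measure_Union) auto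
  also have "prob (?R \<union> ?L) = prob ?R + prob ?L"
    using meas by (intro finite_measure_Union) auto
  finally show ?thesis
    by (simp add: position_step_prob(2) mult.commute)
qed

lemma position_prob_eq_0:
  assumes "int n + 1 < x" "0 \<le> y"
  shows "position_prob n x y = 0"
proof -
  have "position s n \<noteq> (x, y)" for s
    using assms position_bound[of s n] by (auto simp: region_iff)
  then show ?thesis by (simp add: position_prob_def)
qed

text \<open>
  In the induction, the left and diagonal terms combine by the Pascal rule for the binomial weight, and
  the result combines with the right term by the Pascal rule for the ballot number. On the diagonal
  \<open>a = b\<close> the right term disappears, since the walk would have to come from the axis, and so does
  its ballot number.
\<close>
lemma position_law:
  assumes "b \<le> a"
  shows "position_prob (a + b) (1 + int a - int b) (int y)
    = ballot a b * p Right_Step ^ a * split_weight (p Left_Step) (p Diag_Step) b y"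
  using assms
proof (induction "a + b" arbitrary: a b y)
  case 0
  then show ?case
    by (cases y) (auto simp: position_prob_def ballot_def split_weight_def prob_space)
next
  case (Suc n)
  let ?w = "split_weight (p Left_Step) (p Diag_Step)"
  obtain a' where a: "a = Suc a'" using Suc.hyps(2) Suc.prems by (cases a) auto
  have n: "n = a' + b" using Suc.hyps(2) a by simp
  have down: "p Left_Step * position_prob n (2 + int a - int b) (int y)
      + (if y = 0 then 0 else p Diag_Step * position_prob n (2 + int a - int b) (int y - 1))
    = (if b = 0 then 0 else ballot a (b - 1) * p Right_Step ^ a * ?w b y)"
  proof (cases b)
    case 0
    then show ?thesis using n a by (simp add: position_prob_eq_0)
  next
    case (Suc b')
    have "position_prob n (2 + int a - int b) (int z) = ballot a b' * p Right_Step ^ a * ?w b' z" for z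
      using Suc.hyps(1)[of a b' z] Suc.prems Suc n a by (simp add: algebra_simps)
    from this[of y] this[of "y - 1"] show ?thesis
      unfolding Suc split_weight_Suc by (cases y) (simp_all add: algebra_simps)
  qed
  have right: "(if b < a then p Right_Step * position_prob n (int a - int b) (int y) else 0)
      = ballot a' b * p Right_Step ^ a * ?w b y"
  proof (cases "b < a")
    case True
    then show ?thesis
      using Suc.hyps(1)[of a' b y] n a by simp
  next
    case False
    then have "b = Suc a'" using Suc.prems a by simp
    then show ?thesis using a by (simp add: ballot_below_diagonal)
  qed
  have "position_prob (Suc n) (1 + int a - int b) (int y)
      = ballot a' b * p Right_Step ^ a * ?w b y
        + (if b = 0 then 0 else ballot a (b - 1) * p Right_Step ^ a * ?w b y)"
    unfolding right[symmetric] down[symmetric]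
    using Suc.prems by (subst position_prob_Suc) (auto simp: algebra_simps)
  also have "\<dots> = ballot a b * p Right_Step ^ a * ?w b y"
    by (cases b) (simp_all add: a ballot_0_right ballot_Suc_Suc algebra_simps)
  finally show ?case using Suc.hyps(2) by simp
qed

lemma prob_exits:
  "prob {\<omega> \<in> space M. exits (path \<omega>) k y}
     = ballot k k * p Right_Step ^ k * (p Left_Step + p Diag_Step)
       * split_weight (p Left_Step) (p Diag_Step) k y"
proof -
  let ?E = "\<lambda>s. {\<omega> \<in> space M. position (path \<omega>) (2 * k) = (1, int y) \<and> X (2 * k) \<omega> = s}"
  have not_right: "t \<noteq> Right_Step \<longleftrightarrow> t = Left_Step \<or> t = Diag_Step" for t
    by (cases t) simp_all
  have "{\<omega> \<in> space M. exits (path \<omega>) k y} = ?E Left_Step \<union> ?E Diag_Step"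
    using not_right by (auto simp: exits_def)
  moreover have disj: "?E Left_Step \<inter> ?E Diag_Step = {}"
    by auto
  ultimately have "prob {\<omega> \<in> space M. exits (path \<omega>) k y} = prob (?E Left_Step) + prob (?E Diag_Step)"
    using finite_measure_Union[OF position_step_prob(1) position_step_prob(1) disj] by simp
  also have "\<dots> = position_prob (2 * k) 1 (int y) * (p Left_Step + p Diag_Step)"
    by (simp add: position_step_prob(2) algebra_simps)
  finally show ?thesis
    using position_law[of k k y] by (simp add: mult_2)
qed

lemma prob_exits_sum:
  "(\<Sum>y\<le>k. prob {\<omega> \<in> space M. exits (path \<omega>) k y})
     = ballot k k * p Right_Step ^ k * (p Left_Step + p Diag_Step) ^ Suc k"
  by (simp add: prob_exits sum_distrib_left[symmetric] split_weight_sum)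

section \<open>Expected values\<close>

text \<open>
  The exit events are pairwise disjoint, so a statistic that is constant on each of them and zero
  elsewhere is a countable combination of their indicators.
\<close>
lemma nn_integral_exits:
  fixes g :: "(nat \<Rightarrow> step) \<Rightarrow> nat" and f :: "nat \<Rightarrow> nat \<Rightarrow> nat"
  assumes exit: "\<And>s k y. exits s k y \<Longrightarrow> g s = f k y"
    and no_exit: "\<And>s. \<nexists>k y. exits s k y \<Longrightarrow> g s = 0"
  shows "(\<integral>\<^sup>+ \<omega>. of_nat (g (path \<omega>)) \<partial>M)
    = (\<Sum>k. ennreal (\<Sum>y\<le>k. real (f k y) * prob {\<omega> \<in> space M. exits (path \<omega>) k y}))"
proof -
  let ?E = "\<lambda>k y. {\<omega> \<in> space M. exits (path \<omega>) k y}"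
  have "of_nat (g (path \<omega>)) = (\<Sum>k. \<Sum>y\<le>k. of_nat (f k y) * indicator (?E k y) \<omega> :: ennreal)"
    if \<omega>: "\<omega> \<in> space M" for \<omega>
  proof (cases "\<exists>k y. exits (path \<omega>) k y")
    case True
    then obtain k y where ky: "exits (path \<omega>) k y" by blast
    have ind: "indicator (?E k' y') \<omega> = (if k' = k \<and> y' = y then 1 else 0 :: ennreal)" for k' y'
    proof -
      have "exits (path \<omega>) k' y' \<longleftrightarrow> k' = k \<and> y' = y"
        using exits_unique[OF ky] ky by blast
      then show ?thesis using \<omega> by (simp add: indicator_def)
    qed
    have "(\<Sum>k'. \<Sum>y'\<le>k'. of_nat (f k' y') * indicator (?E k' y') \<omega> :: ennreal)
        = (\<Sum>k'\<in>{k}. \<Sum>y'\<le>k'. of_nat (f k' y') * indicator (?E k' y') \<omega>)"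
      by (rule suminf_finite) (auto simp: ind)
    also have "\<dots> = of_nat (f k y)"
      using exits_morse_function(1)[OF ky] by (simp add: ind mult_delta_right)
    finally show ?thesis using exit[OF ky] by simp
  next
    case False
    then show ?thesis using no_exit[of "path \<omega>"] by (simp add: indicator_def)
  qed
  then have "(\<integral>\<^sup>+ \<omega>. of_nat (g (path \<omega>)) \<partial>M)
      = (\<integral>\<^sup>+ \<omega>. (\<Sum>k. \<Sum>y\<le>k. of_nat (f k y) * indicator (?E k y) \<omega>) \<partial>M)"
    by (intro nn_integral_cong)
  also have "\<dots> = (\<Sum>k. \<integral>\<^sup>+ \<omega>. (\<Sum>y\<le>k. of_nat (f k y) * indicator (?E k y) \<omega>) \<partial>M)"
    by (rule nn_integral_suminf) measurable
  also have "\<dots> = (\<Sum>k. \<Sum>y\<le>k. of_nat (f k y) * emeasure M (?E k y))"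
  proof (rule suminf_cong)
    fix k
    have "(\<integral>\<^sup>+ \<omega>. (\<Sum>y\<le>k. of_nat (f k y) * indicator (?E k y) \<omega>) \<partial>M)
        = (\<Sum>y\<le>k. \<integral>\<^sup>+ \<omega>. of_nat (f k y) * indicator (?E k y) \<omega> \<partial>M)"
      by (rule nn_integral_sum) measurable
    then show "(\<integral>\<^sup>+ \<omega>. (\<Sum>y\<le>k. of_nat (f k y) * indicator (?E k y) \<omega>) \<partial>M)
        = (\<Sum>y\<le>k. of_nat (f k y) * emeasure M (?E k y))"
      by (simp only: nn_integral_cmult_indicator[OF exits_events])
  qed
  also have "\<dots> = (\<Sum>k. ennreal (\<Sum>y\<le>k. real (f k y) * prob (?E k y)))"
    by (simp add: emeasure_eq_measure ennreal_of_nat_eq_real_of_nat ennreal_mult'[symmetric] sum_ennreal)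
  finally show ?thesis .
qed

end

theorem proposition3p1:
  fixes M :: "'a measure"
    and X :: "nat \<Rightarrow> 'a \<Rightarrow> step"
    and p_r p_l p_d :: real
  assumes "prob_space M"
    and "prob_space.indep_vars M (\<lambda>_. count_space UNIV) X UNIV"
    and "\<And>i. measure M {\<omega> \<in> space M. X i \<omega> = Right_Step} = p_r"
    and "\<And>i. measure M {\<omega> \<in> space M. X i \<omega> = Left_Step} = p_l"
    and "\<And>i. measure M {\<omega> \<in> space M. X i \<omega> = Diag_Step} = p_d"
    and "p_r > 0" "p_l > 0" "p_d > 0"
    and "p_r + p_l + p_d = 1"
    and "p_l + p_d \<ge> p_r"
  shows
    "measure M {\<omega> \<in> space M. \<exists>n z. position (\<lambda>i. X i \<omega>) n = (0, z)} = 1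
     \<and>
     (\<forall>n::nat. even n \<longrightarrow>
       measure M {\<omega> \<in> space M. \<exists>d. morse_function (\<lambda>i. X i \<omega>) = Some d
           \<and> closed_surface d \<and> critical_points d = n + 2}
         = 1 / real (n + 1) * real ((n + 1) choose ((n + 2) div 2))
             * p_r ^ (n div 2) * (p_l + p_d) ^ ((n + 2) div 2))
     \<and>
     (p_l + p_d > p_r \<longrightarrow>
       (\<integral>\<^sup>+ \<omega>. of_nat (num_critical_points (\<lambda>i. X i \<omega>)) \<partial>M)
         = ennreal (1 + 1 / (p_l + p_d - p_r)))
     \<and>
     (p_l + p_d = p_r \<longrightarrow>
       (\<integral>\<^sup>+ \<omega>. of_nat (num_critical_points (\<lambda>i. X i \<omega>)) \<partial>M) = \<infinity>)
     \<and>
     (\<forall>(y::nat) (n::nat). even n \<longrightarrow>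
       measure M {\<omega> \<in> space M. \<exists>d. morse_function (\<lambda>i. X i \<omega>) = Some d
           \<and> closed_surface d \<and> genus d = y \<and> critical_points d = n + 2}
         = 1 / real (n + 1) * real ((n + 1) choose ((n + 2) div 2))
             * p_r ^ (n div 2) * (p_l + p_d)
             * real ((n div 2) choose y) * p_l ^ (n div 2 - y) * p_d ^ y
       \<and>
       measure M {\<omega> \<in> space M. position (\<lambda>i. X i \<omega>) n = (1, int y)
           \<and> (\<exists>z. position (\<lambda>i. X i \<omega>) (n + 1) = (0, z))}
         = 1 / real (n + 1) * real ((n + 1) choose ((n + 2) div 2))
             * p_r ^ (n div 2) * (p_l + p_d)
             * real ((n div 2) choose y) * p_l ^ (n div 2 - y) * p_d ^ y)
     \<and>
     (p_l + p_d > p_r \<longrightarrow>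
       (\<integral>\<^sup>+ \<omega>. of_nat (num_local_maxima (\<lambda>i. X i \<omega>)) \<partial>M)
         = ennreal (((p_d + p_l / 2) * (p_l + p_d - p_r) + p_l / 2)
                    / ((p_l + p_d) * (p_l + p_d - p_r))))"
proof -
  define p where "p = case_step p_r p_l p_d"
  have p [simp]: "p Right_Step = p_r" "p Left_Step = p_l" "p Diag_Step = p_d"
    by (simp_all add: p_def)
  interpret prob_space M by fact
  interpret random_walk M X p
  proof
    show "indep_vars (\<lambda>_. count_space UNIV) X UNIV" by fact
    show "prob {\<omega> \<in> space M. X i \<omega> = s} = p s" for i s
      using assms(3-5) by (cases s) simp_all
  qed
  define q where "q = p_l + p_d"
  have q: "0 < p_r" "p_r \<le> q" "p_r + q = 1"
    using assms(6-10) by (simp_all add: q_def)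
  then have "0 < q" by simp
  let ?w = "\<lambda>k. ballot k k * p_r ^ k * q ^ Suc k"
  let ?E = "\<lambda>k y. {\<omega> \<in> space M. exits (path \<omega>) k y}"
  have w_nonneg: "0 \<le> ?w k" for k
    unfolding ballot_diagonal_eq using q \<open>0 < q\<close> by simp
  have exits: "prob (?E k y) = 1 / real (2 * k + 1) * real ((2 * k + 1) choose ((2 * k + 2) div 2))
      * p_r ^ k * (p_l + p_d) * real (k choose y) * p_l ^ (k - y) * p_d ^ y" for k y
    by (simp only: prob_exits split_weight_def ballot_diagonal_eq p mult.assoc)
  have exits_sum: "(\<Sum>y\<le>k. prob (?E k y)) = ?w k" for k
    by (simp add: prob_exits_sum q_def)

  have reach: "prob {\<omega> \<in> space M. \<exists>n z. position (path \<omega>) n = (0, z)} = 1"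
  proof -
    let ?A = "{\<omega> \<in> space M. \<exists>k y. exits (path \<omega>) k y}"
    have meas: "?A \<in> events" by measurable
    have "emeasure M ?A = (\<integral>\<^sup>+ \<omega>. of_nat (if \<exists>k y. exits (path \<omega>) k y then 1 else 0) \<partial>M)"
      unfolding nn_integral_indicator[OF meas, symmetric]
      by (intro nn_integral_cong) (simp add: indicator_def)
    also have "\<dots> = (\<Sum>k. ennreal (?w k))"
      by (subst nn_integral_exits[where f = "\<lambda>_ _. 1"]) (auto simp: exits_sum)
    also have "\<dots> = ennreal 1"
      by (rule suminf_ennreal_eq[OF w_nonneg exit_weights_sum_1[OF q]])
    finally show ?thesis
      unfolding reaches_axis_iff_exits by (simp add: emeasure_eq_measure)
  qed

  have size: "prob {\<omega> \<in> space M. \<exists>d. morse_function (path \<omega>) = Some d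
        \<and> closed_surface d \<and> critical_points d = 2 * k + 2} = ?w k" for k
  proof -
    have "{\<omega> \<in> space M. \<exists>y\<le>k. exits (path \<omega>) k y} = (\<Union>y\<in>{..k}. ?E k y)"
      by auto
    moreover have "disjoint_family_on (?E k) {..k}"
      using exits_unique by (auto simp: disjoint_family_on_def)
    ultimately show ?thesis
      unfolding morse_function_size_iff exits_sum[symmetric]
      by (simp add: finite_measure_finite_Union image_subset_iff)
  qed

  have critical: "(\<integral>\<^sup>+ \<omega>. of_nat (num_critical_points (path \<omega>)) \<partial>M)
      = (\<Sum>k. ennreal (real (2 * k + 2) * ?w k))"
    by (subst nn_integral_exits[where f = "\<lambda>k _. 2 * k + 2"])
       (auto simp: num_critical_points_exits num_no_exit sum_distrib_left[symmetric] exits_sum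
             simp del: of_nat_add of_nat_mult)

  (* A walk of length 2 * k has 1 + k * p_l / q maxima on average. Writing the factor k with the help
     of 2 * k + 2 leaves only the two series already evaluated. *)
  have maxima: "(\<integral>\<^sup>+ \<omega>. of_nat (num_local_maxima (path \<omega>)) \<partial>M)
      = (\<Sum>k. ennreal (?w k + p_l / (2 * q) * (real (2 * k + 2) * ?w k - 2 * ?w k)))"
  proof -
    have "(\<Sum>y\<le>k. real (1 + k - y) * prob (?E k y))
        = ?w k + p_l / (2 * q) * (real (2 * k + 2) * ?w k - 2 * ?w k)" for k
    proof -
      have "(\<Sum>y\<le>k. real (1 + k - y) * prob (?E k y))
          = ballot k k * p_r ^ k * q * (\<Sum>y\<le>k. real (1 + k - y) * split_weight p_l p_d k y)"
        unfolding sum_distrib_left prob_exits p q_def by (intro sum.cong) (simp_all add: mult_ac)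
      then show ?thesis
        unfolding split_weight_mean q_def[symmetric]
        using \<open>0 < q\<close> by (cases k) (simp_all add: field_simps)
    qed
    then show ?thesis
      by (subst nn_integral_exits[where f = "\<lambda>k y. 1 + k - y"])
         (auto simp: num_local_maxima_exits num_no_exit simp del: of_nat_diff of_nat_add)
  qed

  have mean_maxima: "(\<integral>\<^sup>+ \<omega>. of_nat (num_local_maxima (path \<omega>)) \<partial>M)
      = ennreal (((p_d + p_l / 2) * (q - p_r) + p_l / 2) / (q * (q - p_r)))"
    if less: "p_r < q"
  proof -
    have sums: "(\<lambda>k. ?w k + p_l / (2 * q) * (real (2 * k + 2) * ?w k - 2 * ?w k)) sums
        (1 + p_l / (2 * q) * ((1 + 1 / (q - p_r)) - 2 * 1))"
      by (intro sums_add sums_mult sums_diff exit_weights_sum_1[OF q] mean_weights_sum[OF q less])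
    have eq: "1 + p_l / (2 * q) * ((1 + 1 / (q - p_r)) - 2 * 1)
        = ((p_d + p_l / 2) * (q - p_r) + p_l / 2) / (q * (q - p_r))"
    proof -
      have "p_d = q - p_l" by (simp add: q_def)
      then show ?thesis
        unfolding \<open>p_d = q - p_l\<close> using \<open>0 < q\<close> less by (simp add: field_simps)
    qed
    have nonneg: "0 \<le> ?w k + p_l / (2 * q) * (real (2 * k + 2) * ?w k - 2 * ?w k)" for k
    proof -
      have "2 * ?w k \<le> real (2 * k + 2) * ?w k"
        by (intro mult_right_mono w_nonneg) simp
      then have "0 \<le> real (2 * k + 2) * ?w k - 2 * ?w k" by linarith
      moreover have "0 \<le> p_l / (2 * q)" using \<open>0 < q\<close> assms(7) by simp
      ultimately show ?thesis
        by (rule add_nonneg_nonneg[OF w_nonneg mult_nonneg_nonneg[rotated]])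
    qed
    show ?thesis
      unfolding maxima suminf_ennreal_eq[OF nonneg sums] eq ..
  qed

  show ?thesis
  proof (intro conjI allI impI)
    show "prob {\<omega> \<in> space M. \<exists>n z. position (path \<omega>) n = (0, z)} = 1"
      by (rule reach)
  next
    fix n :: nat assume "even n"
    then obtain k where n: "n = 2 * k" by blast
    show "prob {\<omega> \<in> space M. \<exists>d. morse_function (path \<omega>) = Some d
          \<and> closed_surface d \<and> critical_points d = n + 2}
        = 1 / real (n + 1) * real ((n + 1) choose ((n + 2) div 2))
            * p_r ^ (n div 2) * (p_l + p_d) ^ ((n + 2) div 2)"
      unfolding n size ballot_diagonal_eq q_def by simp
  next
    assume "p_r < p_l + p_d"
    then have less: "p_r < q" by (simp add: q_def)
    have "0 \<le> real (2 * k + 2) * ?w k" for k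
      by (intro mult_nonneg_nonneg w_nonneg) simp
    then show "(\<integral>\<^sup>+ \<omega>. of_nat (num_critical_points (path \<omega>)) \<partial>M)
        = ennreal (1 + 1 / (p_l + p_d - p_r))"
      unfolding critical q_def[symmetric]
      by (rule suminf_ennreal_eq[OF _ mean_weights_sum[OF q less]])
  next
    assume "p_l + p_d = p_r"
    then have eq: "p_r = q" by (simp add: q_def)
    have "(\<Sum>k. ennreal (real (2 * k + 2) * ?w k)) = top"
    proof (rule ccontr)
      assume "(\<Sum>k. ennreal (real (2 * k + 2) * ?w k)) \<noteq> top"
      then have "summable (\<lambda>k. real (2 * k + 2) * ?w k)"
        by (intro summable_suminf_not_top mult_nonneg_nonneg w_nonneg) simp_all
      then show False using mean_weights_diverge[OF q eq] by contradiction
    qed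
    then show "(\<integral>\<^sup>+ \<omega>. of_nat (num_critical_points (path \<omega>)) \<partial>M) = \<infinity>"
      unfolding critical by simp
  next
    fix y n :: nat assume "even n"
    then obtain k where n: "n = 2 * k" by blast
    let ?v = "1 / real (n + 1) * real ((n + 1) choose ((n + 2) div 2))
            * p_r ^ (n div 2) * (p_l + p_d)
            * real ((n div 2) choose y) * p_l ^ (n div 2 - y) * p_d ^ y"
    have v: "prob (?E k y) = ?v" unfolding exits n by simp
    show "prob {\<omega> \<in> space M. \<exists>d. morse_function (path \<omega>) = Some d
          \<and> closed_surface d \<and> genus d = y \<and> critical_points d = n + 2} = ?v"
      using v unfolding n morse_function_genus_iff .
    show "prob {\<omega> \<in> space M. position (path \<omega>) n = (1, int y)
          \<and> (\<exists>z. position (path \<omega>) (n + 1) = (0, z))} = ?v"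
      using v unfolding n position_exit_iff .
  next
    assume "p_r < p_l + p_d"
    then show "(\<integral>\<^sup>+ \<omega>. of_nat (num_local_maxima (path \<omega>)) \<partial>M)
        = ennreal (((p_d + p_l / 2) * (p_l + p_d - p_r) + p_l / 2)
                    / ((p_l + p_d) * (p_l + p_d - p_r)))"
      using mean_maxima unfolding q_def by simp
  qed
qed

end
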